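(* Let $L\in\mathbb{R}^{N\times N}$ be an irreducible Laplacian matrix, and apply the randomized Cholesky factorization algorithm (described in the context) to $L$. Then, for every outcome of the random choices, the algorithm never breaks down: for each $k=1,\dots,N-1$, the current diagonal entry satisfies $\ell_{kk}>0$ at the moment the column $G(:,k)=L(:,k)/\sqrt{\ell_{kk}}$ is computed, and $\ell_{NN}=0$ after the for-loop has finished.
   Context: A matrix $L\in\mathbb{R}^{N\times N}$ is a Laplacian matrix if $L=L^\top$, $\sum_{j=1}^N \ell_{ij}=0$ for all $i$, and $\ell_{ij}\le 0$ for $i\ne j$. A matrix $A$ is irreducible if there is no permutation matrix $P$ such that $P^\top AP$ is a block triangular matrix. Write $b_{ij}=e_i-e_j$ with $e_1,\dots,e_N$ the standard basis of $\mathbb{R}^N$. For the current matrix $L=(\ell_{ij})$ and index $k$, let $\mathcal{N}_k=\{i:\ell_{ki}\ne 0,\ i\ne k\}$ and $L^{(k)}=\sum_{i\in\mathcal{N}_k}(-\ell_{ki})\,b_{ki}b_{ki}^\top$. Randomized Cholesky factorization (input: irreducible Laplacian $L\in\mathbb{R}^{N\times N}$; output: lower triangular $G\in\mathbb{R}^{N\times N}$): set $G=0$; for $k=1,\dots,N-1$ do: (i) $G(:,k)=L(:,k)/\sqrt{\ell_{kk}}$; (ii) overwrite $L\leftarrow L-L^{(k)}+\text{SampleClique}(L,k)$. Here $\ell_{ij}$ always denotes the entries of the current (overwritten) matrix $L$, and $L(:,k)$ is its $k$-th column. Procedure SampleClique$(L,k)$: 1. Set $C=0$. Let $\mathcal{N}$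 be the set $\mathcal{N}_k$ sorted in ascending order of $|\ell_{ki}|$, $i\in\mathcal{N}_k$. Set $S=\ell_{kk}$ (which equals $-\sum_{i\in\mathcal{N}_k}\ell_{ki}$). 2. While $|\mathcal{N}|>1$: let $i$ be the first element of $\mathcal{N}$; remove $i$ from $\mathcal{N}$; set $S\leftarrow S+\ell_{ki}$ (so that now $S=-\sum_{j\in\mathcal{N}}\ell_{kj}$); sample a random $j\in\mathcal{N}$, where $j$ is chosen with probability $|\ell_{kj}|/S$; set $C\leftarrow C-\frac{S\,\ell_{ki}}{\ell_{kk}}\,b_{ij}b_{ij}^\top$. 3. Return $C$. *)

theory Defs
  imports
    "HOL-Probability.Probability_Mass_Function"
    "HOL-Combinatorics.Permutations"
    "Jordan_Normal_Form.Matrix"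
begin

text \<open>
  Matrices are those of Jordan_Normal_Form, so the indices 1, ..., N of the mathematics are
  0, ..., N - 1 here.
\<close>

definition laplacian_mat :: "nat \<Rightarrow> real mat \<Rightarrow> bool" where
  "laplacian_mat n L \<longleftrightarrow>
     L \<in> carrier_mat n n \<and>
     transpose_mat L = L \<and>
     (\<forall>i<n. (\<Sum>j<n. L $$ (i, j)) = 0) \<and>
     (\<forall>i<n. \<forall>j<n. i \<noteq> j \<longrightarrow> L $$ (i, j) \<le> 0)"

definition permutation_mat :: "nat \<Rightarrow> real mat \<Rightarrow> bool" where
  "permutation_mat n P \<longleftrightarrow>
     (\<exists>p. p permutes {..<n} \<and> P = mat n n (\<lambda>(i, j). if i = p j then 1 else 0))"

text \<open>
  Two nonempty square diagonal blocks suffice: a block triangular matrix with more of them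
  becomes one with two by merging adjacent blocks. Both orientations count as block triangular.
\<close>

definition block_triangular_mat :: "nat \<Rightarrow> real mat \<Rightarrow> bool" where
  "block_triangular_mat n M \<longleftrightarrow>
     (\<exists>r s A B C D. 0 < r \<and> 0 < s \<and> r + s = n \<and>
        A \<in> carrier_mat r r \<and> B \<in> carrier_mat r s \<and>
        C \<in> carrier_mat s r \<and> D \<in> carrier_mat s s \<and>
        M = four_block_mat A B C D \<and> (B = 0\<^sub>m r s \<or> C = 0\<^sub>m s r))"

definition irreducible_mat :: "nat \<Rightarrow> real mat \<Rightarrow> bool" where
  "irreducible_mat n A \<longleftrightarrow>
     \<not> (\<exists>P. permutation_mat n P \<and> block_triangular_mat n (transpose_mat P * A * P))"

text \<open>The rank-one matrix \<open>b b\<^sup>T\<close> for \<open>b = e\<^sub>i - e\<^sub>j\<close>.\<close>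

definition edge_mat :: "nat \<Rightarrow> nat \<Rightarrow> nat \<Rightarrow> real mat" where
  "edge_mat n i j =
     (let b = mat_of_cols n [unit_vec n i - unit_vec n j] in b * transpose_mat b)"

definition neighbours :: "real mat \<Rightarrow> nat \<Rightarrow> nat set" where
  "neighbours L k = {i. i < dim_col L \<and> L $$ (k, i) \<noteq> 0 \<and> i \<noteq> k}"

definition star_mat :: "real mat \<Rightarrow> nat \<Rightarrow> real mat" where
  "star_mat L k = (let n = dim_row L in
     mat n n (\<lambda>(r, s). \<Sum>i\<in>neighbours L k. - L $$ (k, i) * edge_mat n k i $$ (r, s)))"

text \<open>
  Sorting by absolute value does not determine the order of neighbours of equal weight. The
  algorithm is therefore parameterised by an arbitrary rule \<open>srt\<close> that sorts correctly.
\<close>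

definition neighbour_order :: "(real mat \<Rightarrow> nat \<Rightarrow> nat list) \<Rightarrow> bool" where
  "neighbour_order srt \<longleftrightarrow>
     (\<forall>L k. set (srt L k) = neighbours L k \<and> distinct (srt L k) \<and>
            sorted (map (\<lambda>i. \<bar>L $$ (k, i)\<bar>) (srt L k)))"

lemma neighbour_order_sort_key:
  "neighbour_order (\<lambda>L k. sort_key (\<lambda>i. \<bar>L $$ (k, i)\<bar>) (sorted_list_of_set (neighbours L k)))"
proof -
  have "finite (neighbours L k)" for L k
    by (rule finite_subset[of _ "{..<dim_col L}"]) (auto simp: neighbours_def)
  then show ?thesis
    by (simp add: neighbour_order_def)
qed

text \<open>
  The distribution of the sampled neighbour. \<^const>\<open>embed_pmf\<close> is meaningful only if the weights
  are nonnegative and sum to 1; by the next two lemmas this is the case when \<open>S\<close> is the total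
  weight of the remaining neighbours.
\<close>

definition sample_neighbour :: "real mat \<Rightarrow> nat \<Rightarrow> nat list \<Rightarrow> real \<Rightarrow> nat pmf" where
  "sample_neighbour L k js S = embed_pmf (\<lambda>j. if j \<in> set js then \<bar>L $$ (k, j)\<bar> / S else 0)"

lemma pmf_sample_neighbour:
  assumes "S > 0" "S = (\<Sum>j\<in>set js. \<bar>L $$ (k, j)\<bar>)"
  shows "pmf (sample_neighbour L k js S) j = (if j \<in> set js then \<bar>L $$ (k, j)\<bar> / S else 0)"
proof -
  let ?f = "\<lambda>j. if j \<in> set js then \<bar>L $$ (k, j)\<bar> / S else 0"
  have nonneg: "0 \<le> ?f x" for x using assms(1) by simp
  have "(\<integral>\<^sup>+x. ennreal (?f x) \<partial>count_space UNIV) = (\<Sum>x\<in>set js. ennreal (?f x))"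
    by (rule nn_integral_count_space') auto
  also have "\<dots> = ennreal (\<Sum>x\<in>set js. ?f x)"
    using nonneg by (intro sum_ennreal) blast
  also have "(\<Sum>x\<in>set js. ?f x) = (\<Sum>x\<in>set js. \<bar>L $$ (k, x)\<bar>) / S"
    by (simp add: sum_divide_distrib)
  also have "\<dots> = 1" using assms by simp
  finally have total: "(\<integral>\<^sup>+x. ennreal (?f x) \<partial>count_space UNIV) = 1" by simp
  show ?thesis
    unfolding sample_neighbour_def by (rule pmf_embed_pmf[OF nonneg total])
qed

lemma set_pmf_sample_neighbour:
  assumes "S > 0" "S = (\<Sum>j\<in>set js. \<bar>L $$ (k, j)\<bar>)"
  shows "set_pmf (sample_neighbour L k js S) = {j \<in> set js. L $$ (k, j) \<noteq> 0}"
  using assms(1) by (auto simp: set_pmf_eq pmf_sample_neighbour[OF assms])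

text \<open>
  The while loop, with the list of remaining neighbours, the running value of \<open>S\<close> and the
  accumulator \<open>C\<close> as its state.
\<close>

fun sample_clique_loop ::
  "real mat \<Rightarrow> nat \<Rightarrow> nat list \<Rightarrow> real \<Rightarrow> real mat \<Rightarrow> real mat pmf" where
  "sample_clique_loop L k (i # j # js) S C =
     (let S' = S + L $$ (k, i) in
      bind_pmf (sample_neighbour L k (j # js) S') (\<lambda>j'.
        sample_clique_loop L k (j # js) S'
          (C - (S' * L $$ (k, i) / L $$ (k, k)) \<cdot>\<^sub>m edge_mat (dim_row L) i j')))"
| "sample_clique_loop L k [i] S C = return_pmf C"
| "sample_clique_loop L k [] S C = return_pmf C"

definition sample_clique ::
  "(real mat \<Rightarrow> nat \<Rightarrow> nat list) \<Rightarrow> real mat \<Rightarrow> nat \<Rightarrow> real mat pmf" where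
  "sample_clique srt L k =
     sample_clique_loop L k (srt L k) (L $$ (k, k)) (0\<^sub>m (dim_row L) (dim_row L))"

definition cholesky_step ::
  "(real mat \<Rightarrow> nat \<Rightarrow> nat list) \<Rightarrow> nat \<Rightarrow> real mat \<times> real mat \<Rightarrow> (real mat \<times> real mat) pmf" where
  "cholesky_step srt k = (\<lambda>(L, G).
     map_pmf (\<lambda>C.
       (L - star_mat L k + C,
        mat (dim_row G) (dim_col G)
          (\<lambda>(r, s). if s = k then L $$ (r, k) / sqrt (L $$ (k, k)) else G $$ (r, s))))
       (sample_clique srt L k))"

text \<open>
  Joint distribution of the current \<open>L\<close> and \<open>G\<close> after the first \<open>m\<close> passes through the for loop,
  that is after \<open>k = 0, ..., m - 1\<close> in 0-based numbering. The full algorithm has \<open>m = N - 1\<close>.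
\<close>

primrec cholesky_state ::
  "(real mat \<Rightarrow> nat \<Rightarrow> nat list) \<Rightarrow> real mat \<Rightarrow> nat \<Rightarrow> (real mat \<times> real mat) pmf" where
  "cholesky_state srt L 0 = return_pmf (L, 0\<^sub>m (dim_row L) (dim_row L))"
| "cholesky_state srt L (Suc m) = bind_pmf (cholesky_state srt L m) (cholesky_step srt m)"

end

theory Submission
  imports Defs
begin

text \<open>
  Read a Laplacian matrix as a weighted graph whose edges are the nonzero off-diagonal entries.
  Irreducibility says that this graph is connected. The invariant of the elimination is that, after
  the first \<open>k\<close> vertices are eliminated, the current matrix is a Laplacian with zero rows at
  these vertices and a connected graph on the vertices that remain (\<open>partially_eliminated\<close>).

  The invariant gives both claims. While two or more vertices remain, connectivity
  gives the next pivot vertex an incident edge, so its diagonal entry, the sum of its edge weights,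
  is positive. Once a single vertex remains, its row has no off-diagonal entries and
  sums to zero, so its diagonal entry vanishes.

  One step preserves the invariant because subtracting the star of the pivot \<open>k\<close> only removes the
  edges at \<open>k\<close>, while every possible sampled clique is a graph Laplacian that connects the former
  neighbours of \<open>k\<close>: each neighbour but the last is joined to a later one, so the
  samples form a spanning tree of the neighbours (\<open>sample_clique_loop_connects\<close>).

  Connectivity is expressed by cuts: every partition of the vertices into two nonempty
  parts is crossed by an edge. This avoids paths altogether and matches the block structure in the
  definition of irreducibility.
\<close>

section \<open>Entries and Laplacian structure\<close>

lemma laplacian_matD:
  assumes "laplacian_mat n L"
  shows "L \<in> carrier_mat n n" "dim_row L = n" "dim_col L = n"
    and "\<And>i j. i < n \<Longrightarrow> j < n \<Longrightarrow> L $$ (i, j) = L $$ (j, i)"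
    and "\<And>i. i < n \<Longrightarrow> (\<Sum>j<n. L $$ (i, j)) = 0"
    and "\<And>i j. i < n \<Longrightarrow> j < n \<Longrightarrow> i \<noteq> j \<Longrightarrow> L $$ (i, j) \<le> 0"
proof -
  show car: "L \<in> carrier_mat n n"
    using assms by (simp add: laplacian_mat_def)
  then show "dim_row L = n" "dim_col L = n" by auto
  show "L $$ (i, j) = L $$ (j, i)" if "i < n" "j < n" for i j
  proof -
    have "L $$ (i, j) = transpose_mat L $$ (i, j)"
      using assms by (simp add: laplacian_mat_def)
    also have "\<dots> = L $$ (j, i)" using that car by simp
    finally show ?thesis .
  qed
qed (use assms in \<open>auto simp: laplacian_mat_def\<close>)

lemma laplacian_matI:
  assumes "L \<in> carrier_mat n n"
    and "\<And>i j. i < n \<Longrightarrow> j < n \<Longrightarrow> L $$ (i, j) = L $$ (j, i)"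
    and "\<And>i. i < n \<Longrightarrow> (\<Sum>j<n. L $$ (i, j)) = 0"
    and "\<And>i j. i < n \<Longrightarrow> j < n \<Longrightarrow> i \<noteq> j \<Longrightarrow> L $$ (i, j) \<le> 0"
  shows "laplacian_mat n L"
proof -
  have "transpose_mat L = L"
    using assms(1,2) by (intro eq_matI) auto
  then show ?thesis using assms by (auto simp: laplacian_mat_def)
qed

lemma laplacian_mat_add:
  assumes "laplacian_mat n A" "laplacian_mat n B"
  shows "laplacian_mat n (A + B)"
proof (rule laplacian_matI)
  note A = laplacian_matD[OF assms(1)] and B = laplacian_matD[OF assms(2)]
  show "A + B \<in> carrier_mat n n" using A B by simp
  show "(A + B) $$ (i, j) = (A + B) $$ (j, i)" if "i < n" "j < n" for i j
    using that A(2,3) B(2,3) A(4)[of i j] B(4)[of i j] by simp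
  show "(\<Sum>j<n. (A + B) $$ (i, j)) = 0" if "i < n" for i
    using that A(2,3,5) B(2,3,5) by (simp add: sum.distrib)
  show "(A + B) $$ (i, j) \<le> 0" if "i < n" "j < n" "i \<noteq> j" for i j
    using that A(2,3) B(2,3) A(6)[of i j] B(6)[of i j] by simp
qed

lemma laplacian_diag:
  assumes "laplacian_mat n L" "i < n"
  shows "L $$ (i, i) = (\<Sum>j\<in>{..<n} - {i}. - L $$ (i, j))"
proof -
  have "0 = L $$ (i, i) + (\<Sum>j\<in>{..<n} - {i}. L $$ (i, j))"
    using laplacian_matD(5)[OF assms] assms(2) by (subst (asm) sum.remove[of _ i]) auto
  then show ?thesis by (simp add: sum_negf)
qed

lemma neighbours_subset:
  "laplacian_mat n L \<Longrightarrow> neighbours L k \<subseteq> {..<n} - {k}"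
  by (auto simp: neighbours_def laplacian_matD)

lemma finite_neighbours: "finite (neighbours L k)"
  by (rule finite_subset[of _ "{..<dim_col L}"]) (auto simp: neighbours_def)

lemma neighbour_entry_neg:
  assumes "laplacian_mat n L" "k < n" "i \<in> neighbours L k"
  shows "L $$ (k, i) < 0"
proof -
  have "i < n" "i \<noteq> k" "L $$ (k, i) \<noteq> 0"
    using assms(3) laplacian_matD(3)[OF assms(1)] by (auto simp: neighbours_def)
  then show ?thesis using laplacian_matD(6)[OF assms(1,2), of i] by simp
qed

lemma laplacian_diag_neighbours:
  assumes "laplacian_mat n L" "k < n"
  shows "L $$ (k, k) = (\<Sum>i\<in>neighbours L k. \<bar>L $$ (k, i)\<bar>)"
proof -
  have "L $$ (k, k) = (\<Sum>j\<in>neighbours L k. - L $$ (k, j))"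
    unfolding laplacian_diag[OF assms]
    by (rule sum.mono_neutral_right)
      (use assms in \<open>auto simp: neighbours_def laplacian_matD\<close>)
  also have "\<dots> = (\<Sum>i\<in>neighbours L k. \<bar>L $$ (k, i)\<bar>)"
    by (rule sum.cong) (use neighbour_entry_neg[OF assms] in \<open>auto simp: abs_if\<close>)
  finally show ?thesis .
qed

lemma dim_edge_mat [simp]: "dim_row (edge_mat n i j) = n" "dim_col (edge_mat n i j) = n"
  by (simp_all add: edge_mat_def Let_def)

lemma edge_mat_entry:
  assumes "r < n" "s < n"
  shows "edge_mat n i j $$ (r, s) =
    (of_bool (r = i) - of_bool (r = j)) * (of_bool (s = i) - of_bool (s = j))"
  using assms by (simp add: edge_mat_def Let_def scalar_prod_def mat_of_cols_index unit_vec_def)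

lemma edge_mat_row_sum:
  assumes "r < n" "i < n" "j < n"
  shows "(\<Sum>s<n. edge_mat n i j $$ (r, s)) = 0"
proof -
  have "(\<Sum>s<n. edge_mat n i j $$ (r, s)) =
      (of_bool (r = i) - of_bool (r = j)) * ((\<Sum>s<n. of_bool (s = i)) - (\<Sum>s<n. of_bool (s = j)))"
    using assms by (simp add: edge_mat_entry sum_distrib_left[symmetric] sum_subtractf)
  moreover have "(\<Sum>s<n. of_bool (s = t) :: real) = 1" if "t < n" for t
    using that by (simp add: of_bool_def)
  ultimately show ?thesis using assms by simp
qed

lemma laplacian_mat_edge:
  assumes "i < n" "j < n" "c \<le> 0"
  shows "laplacian_mat n (- (c \<cdot>\<^sub>m edge_mat n i j))"
proof (rule laplacian_matI)
  show "(\<Sum>s<n. (- (c \<cdot>\<^sub>m edge_mat n i j)) $$ (r, s)) = 0" if "r < n" for r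
    using that assms edge_mat_row_sum[of r n i j]
    by (simp add: sum_negf sum_distrib_left[symmetric])
qed (use assms in \<open>auto simp: edge_mat_entry\<close>)

section \<open>Removing the star of the pivot\<close>

lemma star_mat_off_diag:
  assumes "laplacian_mat n L" "k < n" "r < n" "s < n" "r \<noteq> s"
  shows "star_mat L k $$ (r, s) = (if r = k \<or> s = k then L $$ (r, s) else 0)"
proof -
  note L = laplacian_matD[OF assms(1)]
  have nk: "i \<noteq> k" "i < n" if "i \<in> neighbours L k" for i
    using that neighbours_subset[OF assms(1)] by auto
  have *: "star_mat L k $$ (r, s) =
      (\<Sum>i\<in>neighbours L k. - L $$ (k, i) * edge_mat n k i $$ (r, s))"
    using assms L by (simp add: star_mat_def Let_def)
  have single: "(\<Sum>i\<in>neighbours L k. if i = t then L $$ (k, i) else 0) = L $$ (k, t)"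
    if "t < n" "t \<noteq> k" for t
    using that L(3) finite_neighbours[of L k] by (auto simp: neighbours_def)
  consider "r = k" "s \<noteq> k" | "s = k" "r \<noteq> k" | "r \<noteq> k" "s \<noteq> k" using assms(5) by auto
  then show ?thesis
  proof cases
    case 1
    have "star_mat L k $$ (r, s) = (\<Sum>i\<in>neighbours L k. if i = s then L $$ (k, i) else 0)"
      unfolding * using 1 assms nk by (intro sum.cong) (auto simp: edge_mat_entry)
    then show ?thesis using single[of s] 1 assms by simp
  next
    case 2
    have "star_mat L k $$ (r, s) = (\<Sum>i\<in>neighbours L k. if i = r then L $$ (k, i) else 0)"
      unfolding * using 2 assms nk by (intro sum.cong) (auto simp: edge_mat_entry)
    then show ?thesis using single[of r] 2 assms L(4)[of r k] by simp
  next
    case 3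
    have "star_mat L k $$ (r, s) = 0"
      unfolding * using 3 assms nk by (intro sum.neutral) (auto simp: edge_mat_entry)
    then show ?thesis using 3 by simp
  qed
qed

lemma star_mat_carrier: "laplacian_mat n L \<Longrightarrow> star_mat L k \<in> carrier_mat n n"
  by (simp add: star_mat_def Let_def laplacian_matD)

lemma star_mat_row_sum:
  assumes "laplacian_mat n L" "k < n" "r < n"
  shows "(\<Sum>s<n. star_mat L k $$ (r, s)) = 0"
proof -
  have "(\<Sum>s<n. star_mat L k $$ (r, s)) =
      (\<Sum>s<n. \<Sum>i\<in>neighbours L k. - L $$ (k, i) * edge_mat n k i $$ (r, s))"
    using assms by (simp add: star_mat_def Let_def laplacian_matD)
  also have "\<dots> = (\<Sum>i\<in>neighbours L k. - L $$ (k, i) * (\<Sum>s<n. edge_mat n k i $$ (r, s)))"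
    by (subst sum.swap) (simp add: sum_distrib_left)
  also have "\<dots> = 0"
    using assms neighbours_subset[OF assms(1), of k]
    by (intro sum.neutral) (auto simp: subset_iff edge_mat_row_sum)
  finally show ?thesis .
qed

lemma remove_star_off_diag:
  assumes "laplacian_mat n L" "k < n" "r < n" "s < n" "r \<noteq> s"
  shows "(L - star_mat L k) $$ (r, s) = (if r = k \<or> s = k then 0 else L $$ (r, s))"
  using assms star_mat_off_diag[OF assms] star_mat_carrier[OF assms(1), of k] by auto

lemma laplacian_mat_remove_star:
  assumes "laplacian_mat n L" "k < n"
  shows "laplacian_mat n (L - star_mat L k)"
proof (rule laplacian_matI)
  note L = laplacian_matD[OF assms(1)] and S = star_mat_carrier[OF assms(1), of k]
  show "L - star_mat L k \<in> carrier_mat n n" using L S by auto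
  show "(L - star_mat L k) $$ (i, j) = (L - star_mat L k) $$ (j, i)" if "i < n" "j < n" for i j
    using remove_star_off_diag[OF assms, of i j] remove_star_off_diag[OF assms, of j i] that L(4)[of i j]
    by (cases "i = j") auto
  show "(\<Sum>j<n. (L - star_mat L k) $$ (i, j)) = 0" if "i < n" for i
    using that S L(5) star_mat_row_sum[OF assms that] by (simp add: sum_subtractf)
  show "(L - star_mat L k) $$ (i, j) \<le> 0" if "i < n" "j < n" "i \<noteq> j" for i j
    using remove_star_off_diag[OF assms, of i j] that L(6)[of i j] by auto
qed

section \<open>The sampled clique\<close>

text \<open>
  The running total stays the weight of the remaining neighbours, so it is positive as long as
  a sample is drawn, and every sampled edge has positive weight. Later samples only decrease
  off-diagonal entries, so no sampled edge is cancelled. By the comparison with the initial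
  accumulator, the edges sampled from now on connect the list by themselves: in the induction,
  either they cross the cut, or the edge sampled for the first neighbour does.
\<close>

lemma sample_clique_loop_connects:
  assumes L: "laplacian_mat n L" and k: "k < n"
    and "set js \<subseteq> neighbours L k" "distinct js"
    and "S = (\<Sum>j\<in>set js. \<bar>L $$ (k, j)\<bar>)"
    and "laplacian_mat n C0"
    and "C \<in> set_pmf (sample_clique_loop L k js S C0)"
  shows "laplacian_mat n C \<and>
    (\<forall>r<n. \<forall>s<n. r \<noteq> s \<longrightarrow> C $$ (r, s) \<le> C0 $$ (r, s)) \<and>
    (\<forall>r<n. \<forall>s<n. r \<notin> set js \<longrightarrow> C $$ (r, s) = C0 $$ (r, s)) \<and>
    (\<forall>T. set js \<inter> T \<noteq> {} \<longrightarrow> \<not> set js \<subseteq> T \<longrightarrow>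
      (\<exists>a \<in> set js \<inter> T. \<exists>b \<in> set js - T. C $$ (a, b) < C0 $$ (a, b)))"
  using assms(3-)
proof (induction js arbitrary: S C0)
  case Nil
  then show ?case by auto
next
  case (Cons i js)
  have nbr: "i \<in> neighbours L k" and sub: "set js \<subseteq> neighbours L k"
    and dist: "i \<notin> set js" "distinct js"
    using Cons.prems by auto
  show ?case
  proof (cases js)
    case Nil
    then show ?thesis using Cons.prems by auto
  next
    case (Cons j js')
    define S' where "S' = S + L $$ (k, i)"
    define c where "c = S' * L $$ (k, i) / L $$ (k, k)"
    note C0 = laplacian_matD[OF \<open>laplacian_mat n C0\<close>]
    have neg: "L $$ (k, m) < 0" "m < n" if "m \<in> neighbours L k" for m
      using neighbour_entry_neg[OF L k that] neighbours_subset[OF L, of k] that by auto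
    have S': "S' = (\<Sum>m\<in>set js. \<bar>L $$ (k, m)\<bar>)"
      using \<open>S = _\<close> dist neg(1)[OF nbr] by (simp add: S'_def)
    have pos: "0 < (\<Sum>m\<in>M. \<bar>L $$ (k, m)\<bar>)" if "M \<subseteq> neighbours L k" "m \<in> M" for M m
      using that finite_subset[OF that(1) finite_neighbours] neg(1)
      by (intro sum_pos) force+
    have "0 < S'" unfolding S' using pos[OF sub] Cons by auto
    moreover have "0 < L $$ (k, k)"
      unfolding laplacian_diag_neighbours[OF L k] using pos[OF order_refl nbr] .
    ultimately have c: "c < 0"
      using neg(1)[OF nbr] by (simp add: c_def divide_neg_pos mult_pos_neg)
    obtain j' where j': "j' \<in> set_pmf (sample_neighbour L k js S')"
      and C: "C \<in> set_pmf (sample_clique_loop L k js S' (C0 - c \<cdot>\<^sub>m edge_mat n i j'))"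
      using Cons.prems(5) Cons laplacian_matD(2)[OF L]
      by (auto simp: S'_def c_def Let_def)
    have j'_in: "j' \<in> set js"
      using j' set_pmf_sample_neighbour[OF \<open>0 < S'\<close> S'] by auto
    define C1 where "C1 = C0 - c \<cdot>\<^sub>m edge_mat n i j'"
    have ij: "i < n" "j' < n" "i \<noteq> j'"
      using neg(2) nbr sub j'_in dist by auto
    have "C1 = C0 + - (c \<cdot>\<^sub>m edge_mat n i j')"
      unfolding C1_def using C0(2,3) by (intro eq_matI) auto
    then have C1: "laplacian_mat n C1"
      using laplacian_mat_add[OF \<open>laplacian_mat n C0\<close> laplacian_mat_edge[OF ij(1,2)]] c by auto
    have C1_entry: "C1 $$ (r, s) = C0 $$ (r, s) - c * edge_mat n i j' $$ (r, s)"
      if "r < n" "s < n" for r s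
      using that C0(2,3) by (simp add: C1_def)
    have C1_le: "C1 $$ (r, s) \<le> C0 $$ (r, s)" if "r < n" "s < n" "r \<noteq> s" for r s
      using that c ij by (auto simp: C1_entry edge_mat_entry)
    have C1_edge: "C1 $$ (i, j') < C0 $$ (i, j')" "C1 $$ (j', i) < C0 $$ (j', i)"
      using c ij by (auto simp: C1_entry edge_mat_entry)
    note IH = Cons.IH[OF sub dist(2) S' C1 C[folded C1_def]]
    note lap = conjunct1[OF IH] and le_all = conjunct1[OF conjunct2[OF IH]]
      and eq_all = conjunct1[OF conjunct2[OF conjunct2[OF IH]]]
      and sep = conjunct2[OF conjunct2[OF conjunct2[OF IH]]]
    have le: "C $$ (r, s) \<le> C1 $$ (r, s)" if "r < n" "s < n" "r \<noteq> s" for r s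
      using le_all that by simp
    have "\<exists>a \<in> set (i # js) \<inter> T. \<exists>b \<in> set (i # js) - T. C $$ (a, b) < C0 $$ (a, b)"
      if T: "set (i # js) \<inter> T \<noteq> {}" "\<not> set (i # js) \<subseteq> T" for T
    proof (cases "set js \<inter> T \<noteq> {} \<and> \<not> set js \<subseteq> T")
      case True
      then have "set js \<inter> T \<noteq> {}" "\<not> set js \<subseteq> T" by auto
      from sep[rule_format, OF this] obtain a b
        where ab: "a \<in> set js \<inter> T" "b \<in> set js - T" "C $$ (a, b) < C1 $$ (a, b)"
        by (elim bexE)
      then have "C1 $$ (a, b) \<le> C0 $$ (a, b)"
        using neg(2) sub by (intro C1_le) auto
      with ab show ?thesis by (intro bexI[of _ a] bexI[of _ b]) auto
    next
      case False
      (* All later neighbours lie on the same side of the cut, so the edge just sampled for i,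
         which leads to one of them, crosses it. *)
      with T j'_in consider "i \<in> T" "j' \<notin> T" | "i \<notin> T" "j' \<in> T" by auto
      then show ?thesis
      proof cases
        case 1
        moreover have "C $$ (i, j') < C0 $$ (i, j')" using C1_edge(1) le[of i j'] ij by simp
        ultimately show ?thesis using j'_in by (intro bexI[of _ i] bexI[of _ j']) auto
      next
        case 2
        moreover have "C $$ (j', i) < C0 $$ (j', i)" using C1_edge(2) le[of j' i] ij by simp
        ultimately show ?thesis using j'_in by (intro bexI[of _ j'] bexI[of _ i]) auto
      qed
    qed
    moreover have "C $$ (r, s) \<le> C0 $$ (r, s)" if "r < n" "s < n" "r \<noteq> s" for r s
      using le[OF that] C1_le[OF that] by simp
    moreover have "C $$ (r, s) = C0 $$ (r, s)" if "r < n" "s < n" "r \<notin> set (i # js)" for r s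
    proof -
      have "C $$ (r, s) = C1 $$ (r, s)" using eq_all that by simp
      also have "\<dots> = C0 $$ (r, s)" using that j'_in by (auto simp: C1_entry edge_mat_entry)
      finally show ?thesis .
    qed
    ultimately show ?thesis using lap by simp
  qed
qed

lemma laplacian_mat_zero: "laplacian_mat n (0\<^sub>m n n)"
  by (rule laplacian_matI) auto

lemma sample_clique_properties:
  assumes "neighbour_order srt" and L: "laplacian_mat n L" "k < n"
    and C: "C \<in> set_pmf (sample_clique srt L k)"
  shows "laplacian_mat n C"
    and "\<And>r s. r < n \<Longrightarrow> s < n \<Longrightarrow> r \<notin> neighbours L k \<Longrightarrow> C $$ (r, s) = 0"
    and "\<And>T. neighbours L k \<inter> T \<noteq> {} \<Longrightarrow> \<not> neighbours L k \<subseteq> T \<Longrightarrow>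
           \<exists>a \<in> neighbours L k \<inter> T. \<exists>b \<in> neighbours L k - T. C $$ (a, b) < 0"
proof -
  have srt: "set (srt L k) = neighbours L k" "distinct (srt L k)"
    using assms(1) by (auto simp: neighbour_order_def)
  have "C \<in> set_pmf (sample_clique_loop L k (srt L k) (L $$ (k, k)) (0\<^sub>m n n))"
    using C L by (simp add: sample_clique_def laplacian_matD)
  note * = sample_clique_loop_connects[OF L _ srt(2) _ laplacian_mat_zero this,
      unfolded srt(1), OF order_refl laplacian_diag_neighbours[OF L]]
  have bound: "a < n" if "a \<in> neighbours L k" for a
    using neighbours_subset[OF L(1), of k] that by auto
  show "laplacian_mat n C" using * by blast
  show "C $$ (r, s) = 0" if "r < n" "s < n" "r \<notin> neighbours L k" for r s
    using * that by auto
  show "\<exists>a \<in> neighbours L k \<inter> T. \<exists>b \<in> neighbours L k - T. C $$ (a, b) < 0"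
    if T: "neighbours L k \<inter> T \<noteq> {}" "\<not> neighbours L k \<subseteq> T" for T
  proof -
    obtain a b where "a \<in> neighbours L k \<inter> T" "b \<in> neighbours L k - T"
      "C $$ (a, b) < 0\<^sub>m n n $$ (a, b)"
      using conjunct2[OF conjunct2[OF conjunct2[OF *]], rule_format, OF T] by (elim bexE)
    then show ?thesis using bound by (intro bexI[of _ a] bexI[of _ b]) auto
  qed
qed

section \<open>Connectivity and the invariant\<close>

definition cut_connected :: "nat set \<Rightarrow> real mat \<Rightarrow> bool" where
  "cut_connected V L \<longleftrightarrow>
     (\<forall>T \<subseteq> V. T \<noteq> {} \<longrightarrow> T \<noteq> V \<longrightarrow> (\<exists>a\<in>T. \<exists>b\<in>V - T. L $$ (a, b) \<noteq> 0))"

lemma cut_connectedD: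
  assumes "cut_connected V L" "T \<subseteq> V" "T \<noteq> {}" "T \<noteq> V"
  obtains a b where "a \<in> T" "b \<in> V - T" "L $$ (a, b) \<noteq> 0"
  using assms unfolding cut_connected_def by blast

lemma ex_permutes_initial_segment:
  assumes "T \<subseteq> {..<n}"
  obtains p where "p permutes {..<n}" "p ` {..<card T} = T" "p ` {card T..<n} = {..<n} - T"
proof -
  define r where "r = card T"
  have fin: "finite T" using assms finite_subset by blast
  have r: "r \<le> n" unfolding r_def using card_mono[OF _ assms] by simp
  obtain f where f: "bij_betw f {..<r} T"
    using finite_same_card_bij[of "{..<r}" T] fin by (auto simp: r_def)
  have "card {r..<n} = card ({..<n} - T)"
    using card_Diff_subset[OF fin assms] by (simp add: r_def)
  then obtain g where g: "bij_betw g {r..<n} ({..<n} - T)"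
    using finite_same_card_bij[of "{r..<n}" "{..<n} - T"] by auto
  define p where "p = (\<lambda>x. if x < r then f x else if x < n then g x else x)"
  have p1: "bij_betw p {..<r} T"
    using f by (rule bij_betw_cong[THEN iffD1, rotated]) (simp add: p_def)
  have p2: "bij_betw p {r..<n} ({..<n} - T)"
    using g by (rule bij_betw_cong[THEN iffD1, rotated]) (simp add: p_def)
  have un: "{..<r} \<union> {r..<n} = {..<n}" "T \<union> ({..<n} - T) = {..<n}"
    using r assms by auto
  have "bij_betw p ({..<r} \<union> {r..<n}) (T \<union> ({..<n} - T))"
    by (rule bij_betw_combine[OF p1 p2]) auto
  then have "bij_betw p {..<n} {..<n}" unfolding un .
  then have "p permutes {..<n}"
    using r by (intro bij_imp_permutes) (auto simp: p_def)
  with p1 p2 that show thesis by (auto simp: bij_betw_def r_def)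
qed

lemma permuted_entry:
  fixes A :: "real mat"
  assumes "A \<in> carrier_mat n n" "p permutes {..<n}" "i < n" "j < n"
    and P: "P = mat n n (\<lambda>(i, j). if i = p j then 1 else 0)"
  shows "(transpose_mat P * A * P) $$ (i, j) = A $$ (p i, p j)"
proof -
  have p: "p i < n" "p j < n"
    using permutes_in_image[OF assms(2), of i] permutes_in_image[OF assms(2), of j] assms(3,4)
    by auto
  have P_carrier: "P \<in> carrier_mat n n" by (simp add: P)
  have unit: "row (transpose_mat P) i = unit_vec n (p i)" "col P j = unit_vec n (p j)"
    using assms(3,4) by (auto simp: P unit_vec_def intro!: eq_vecI)
  have PA: "transpose_mat P * A \<in> carrier_mat n n"
    using P_carrier assms(1) by (intro mult_carrier_mat[of _ n n]) auto
  have "(transpose_mat P * A * P) $$ (i, j) = row (transpose_mat P * A) i \<bullet> unit_vec n (p j)"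
    using PA P_carrier assms(3,4) by (simp add: unit)
  also have "\<dots> = (transpose_mat P * A) $$ (i, p j)"
    using PA p assms(3) scalar_prod_right_unit[of "p j" n "row (transpose_mat P * A) i"]
    by (simp del: index_mult_mat)
  also have "\<dots> = unit_vec n (p i) \<bullet> col A (p j)"
    using P_carrier assms(1,3) p by (simp add: unit)
  also have "\<dots> = A $$ (p i, p j)"
    using p assms(1) scalar_prod_left_unit[of "col A (p j)" n "p i"] by simp
  finally show ?thesis .
qed

text \<open>
  Listing the vertices on one side of an uncrossed cut first yields a block triangular matrix.
\<close>

lemma irreducible_imp_cut_connected:
  assumes A: "A \<in> carrier_mat n n" and "irreducible_mat n A"
  shows "cut_connected {..<n} A"
proof (rule ccontr)
  assume "\<not> cut_connected {..<n} A"
  then obtain T where T: "T \<subseteq> {..<n}" "T \<noteq> {}" "T \<noteq> {..<n}"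
    and uncrossed: "\<And>a b. a \<in> T \<Longrightarrow> b \<in> {..<n} - T \<Longrightarrow> A $$ (a, b) = 0"
    by (auto simp: cut_connected_def)
  obtain p where p: "p permutes {..<n}" "p ` {..<card T} = T" "p ` {card T..<n} = {..<n} - T"
    using ex_permutes_initial_segment[OF T(1)] .
  define P :: "real mat" where "P = mat n n (\<lambda>(i, j). if i = p j then 1 else 0)"
  define M where "M = transpose_mat P * A * P"
  define r where "r = card T"
  have r: "0 < r" "r < n"
    using T psubset_card_mono[of "{..<n}" T] finite_subset[OF T(1)]
    by (auto simp: r_def card_gt_0_iff)
  have M: "M \<in> carrier_mat n n"
    unfolding M_def P_def using A by (intro mult_carrier_mat[of _ n n]) auto
  have zero: "M $$ (i, j) = 0" if "i < r" "r \<le> j" "j < n" for i j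
  proof -
    have "M $$ (i, j) = A $$ (p i, p j)"
      unfolding M_def using that r by (intro permuted_entry[OF A p(1) _ _ P_def]) auto
    also have "p i \<in> p ` {..<card T}" "p j \<in> p ` {card T..<n}" using that by (auto simp: r_def)
    then have "A $$ (p i, p j) = 0" unfolding p by (rule uncrossed)
    finally show ?thesis .
  qed
  let ?A = "mat r r (\<lambda>(i, j). M $$ (i, j))"
  let ?C = "mat (n - r) r (\<lambda>(i, j). M $$ (i + r, j))"
  let ?D = "mat (n - r) (n - r) (\<lambda>(i, j). M $$ (i + r, j + r))"
  have "M = four_block_mat ?A (0\<^sub>m r (n - r)) ?C ?D"
    using M r zero by (intro eq_matI) auto
  then have "block_triangular_mat n M"
    unfolding block_triangular_mat_def using r
    by (intro exI[of _ r] exI[of _ "n - r"] exI[of _ ?A] exI[of _ "0\<^sub>m r (n - r)"]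
        exI[of _ ?C] exI[of _ ?D]) auto
  moreover have "permutation_mat n P"
    using p(1) by (auto simp: permutation_mat_def P_def)
  ultimately show False
    using \<open>irreducible_mat n A\<close> by (auto simp: irreducible_mat_def M_def)
qed

definition partially_eliminated :: "nat \<Rightarrow> nat \<Rightarrow> real mat \<Rightarrow> bool" where
  "partially_eliminated n k L \<longleftrightarrow>
     laplacian_mat n L \<and> (\<forall>i<k. \<forall>j<n. L $$ (i, j) = 0) \<and> cut_connected {k..<n} L"

lemma partially_eliminated_diag_pos:
  assumes "partially_eliminated n k L" "Suc k < n"
  shows "0 < L $$ (k, k)"
proof -
  have L: "laplacian_mat n L" "k < n" and conn: "cut_connected {k..<n} L"
    using assms by (auto simp: partially_eliminated_def)
  have "{k} \<noteq> {k..<n}"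
  proof
    assume "{k} = {k..<n}"
    moreover have "Suc k \<in> {k..<n}" using assms(2) by simp
    ultimately show False by (metis singletonD n_not_Suc_n)
  qed
  then obtain b where b: "b \<in> {k..<n} - {k}" "L $$ (k, b) \<noteq> 0"
    using cut_connectedD[OF conn, of "{k}"] L(2) by auto
  then have "b \<in> neighbours L k" using L by (auto simp: neighbours_def laplacian_matD)
  then show ?thesis
    unfolding laplacian_diag_neighbours[OF L] using neighbour_entry_neg[OF L]
    by (intro sum_pos finite_neighbours) force+
qed

lemma partially_eliminated_last_diag:
  assumes "partially_eliminated (Suc k) k L"
  shows "L $$ (k, k) = 0"
proof -
  have L: "laplacian_mat (Suc k) L" and zero: "\<forall>i<k. \<forall>j<Suc k. L $$ (i, j) = 0"
    using assms by (auto simp: partially_eliminated_def)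
  have "L $$ (k, j) = 0" if "j < k" for j
    using laplacian_matD(4)[OF L, of k j] zero that by simp
  then show ?thesis using laplacian_diag[OF L, of k] by auto
qed

text \<open>
  Off-diagonal entries of both summands are nonpositive, so an edge of either is an edge of the sum.
  A cut of the remaining vertices that separates two former neighbours of \<open>k\<close> is therefore crossed
  by a clique edge. If all former neighbours lie on one side, add \<open>k\<close> to that side: the edge that
  crosses this cut before the step is not incident with \<open>k\<close>, so the step keeps it.
\<close>

lemma partially_eliminated_step:
  assumes srt: "neighbour_order srt" and inv: "partially_eliminated n k L" and k: "k < n"
    and C: "C \<in> set_pmf (sample_clique srt L k)"
  shows "partially_eliminated n (Suc k) (L - star_mat L k + C)"
proof -
  have L: "laplacian_mat n L" and zero: "\<And>i j. i < k \<Longrightarrow> j < n \<Longrightarrow> L $$ (i, j) = 0"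
    and conn: "cut_connected {k..<n} L"
    using inv by (auto simp: partially_eliminated_def)
  note Lp = laplacian_matD[OF L] and clique = sample_clique_properties[OF srt L k C]
  let ?L = "L - star_mat L k + C"
  have lap: "laplacian_mat n ?L"
    using laplacian_mat_add[OF laplacian_mat_remove_star[OF L k] clique(1)] .
  have entry: "?L $$ (r, s) = (if r = k \<or> s = k then 0 else L $$ (r, s)) + C $$ (r, s)"
    if "r < n" "s < n" "r \<noteq> s" for r s
    using remove_star_off_diag[OF L k that] laplacian_matD(2,3)[OF clique(1)] that by simp
  have nbr_gt: "k < i \<and> i < n" if "i \<in> neighbours L k" for i
  proof -
    have "i < n" "i \<noteq> k" "L $$ (k, i) \<noteq> 0"
      using that Lp(3) by (auto simp: neighbours_def)
    moreover have "\<not> i < k"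
      using zero[of i k] Lp(4)[of k i] calculation k by auto
    ultimately show ?thesis by auto
  qed
  have zero': "?L $$ (i, j) = 0" if "i < Suc k" "j < n" for i j
  proof -
    have off: "?L $$ (i, j) = 0" if "j < n" "i \<noteq> j" for j
    proof -
      have "i \<notin> neighbours L k" using nbr_gt \<open>i < Suc k\<close> by force
      then show ?thesis
        using entry[of i j] clique(2)[of i j] zero[of i j] that \<open>i < Suc k\<close> k
        by (auto simp: less_Suc_eq)
    qed
    moreover have "?L $$ (i, i) = 0"
      unfolding laplacian_diag[OF lap less_le_trans[OF \<open>i < Suc k\<close> Suc_leI[OF k]]]
      using off by (intro sum.neutral) auto
    ultimately show ?thesis using that by (cases "i = j") auto
  qed
  have "\<exists>a\<in>T. \<exists>b\<in>{Suc k..<n} - T. ?L $$ (a, b) \<noteq> 0"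
    if T: "T \<subseteq> {Suc k..<n}" "T \<noteq> {}" "T \<noteq> {Suc k..<n}" for T
  proof -
    have neg: ?thesis
      if "a \<in> T" "b \<in> {Suc k..<n} - T" "L $$ (a, b) < 0 \<or> C $$ (a, b) < 0" for a b
    proof -
      have ab: "a < n" "b < n" "a \<noteq> b" "a \<noteq> k" "b \<noteq> k" using that T by auto
      have "?L $$ (a, b) < 0"
        using entry[OF ab(1-3)] ab that(3) Lp(6)[OF ab(1-3)]
          laplacian_matD(6)[OF clique(1) ab(1-3)] by auto
      then show ?thesis using that by (intro bexI[of _ a] bexI[of _ b]) auto
    qed
    have survives: ?thesis if "a \<in> T" "b \<in> {Suc k..<n} - T" "L $$ (a, b) \<noteq> 0" for a b
    proof -
      have "a < n" "b < n" "a \<noteq> b" using that T by auto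
      then show ?thesis using neg[of a b] that Lp(6)[of a b] by auto
    qed
    have adj: "b \<in> neighbours L k"
      if "Suc k \<le> b" "b < n" "L $$ (k, b) \<noteq> 0 \<or> L $$ (b, k) \<noteq> 0" for b
      using that k Lp(3) Lp(4)[of k b] by (auto simp: neighbours_def)
    consider (split) "neighbours L k \<inter> T \<noteq> {}" "\<not> neighbours L k \<subseteq> T"
      | (inside) "neighbours L k \<subseteq> T" | (outside) "neighbours L k \<inter> T = {}" by blast
    then show ?thesis
    proof cases
      case split
      then obtain a b where "a \<in> neighbours L k \<inter> T" "b \<in> neighbours L k - T" "C $$ (a, b) < 0"
        using clique(3) by blast
      then show ?thesis using neg[of a b] nbr_gt[of b] by auto
    next
      case inside
      have "insert k T \<subseteq> {k..<n}" "insert k T \<noteq> {}" "insert k T \<noteq> {k..<n}"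
        using T k by (auto simp: Suc_le_eq)
      then obtain a b where ab: "a \<in> insert k T" "b \<in> {k..<n} - insert k T" "L $$ (a, b) \<noteq> 0"
        by (rule cut_connectedD[OF conn])
      then have "a \<in> T" using adj[of b] inside by auto
      with ab show ?thesis by (intro survives[of a b]) auto
    next
      case outside
      have "T \<subseteq> {k..<n}" "T \<noteq> {}" "T \<noteq> {k..<n}" using T k by auto
      then obtain a b where ab: "a \<in> T" "b \<in> {k..<n} - T" "L $$ (a, b) \<noteq> 0"
        by (rule cut_connectedD[OF conn])
      then have "a \<notin> neighbours L k" "Suc k \<le> a" "a < n" using outside T(1) by auto
      then have "b \<noteq> k" using adj[of a] ab(3) by auto
      with ab show ?thesis by (intro survives[of a b]) auto
    qed
  qed
  then show ?thesis
    using lap zero' by (auto simp: partially_eliminated_def cut_connected_def)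
qed

lemma cholesky_state_partially_eliminated:
  assumes "neighbour_order srt" "laplacian_mat n L" "irreducible_mat n L" "m \<le> n"
    and "(L', G) \<in> set_pmf (cholesky_state srt L m)"
  shows "partially_eliminated n m L'"
  using assms(4,5)
proof (induction m arbitrary: L' G)
  case 0
  then show ?case
    using assms(2) irreducible_imp_cut_connected[OF laplacian_matD(1)[OF assms(2)] assms(3)]
    by (simp add: partially_eliminated_def atLeast0LessThan)
next
  case (Suc m)
  then obtain L1 G1 C where "(L1, G1) \<in> set_pmf (cholesky_state srt L m)"
    and C: "C \<in> set_pmf (sample_clique srt L1 m)" "L' = L1 - star_mat L1 m + C"
    by (auto simp: cholesky_step_def)
  then have "partially_eliminated n m L1" using Suc by auto
  then show ?case
    using partially_eliminated_step[OF assms(1) _ _ C(1)] Suc.prems(1) C(2) by auto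
qed

theorem corollary2p8:
  fixes L :: "real mat" and N :: nat and srt :: "real mat \<Rightarrow> nat \<Rightarrow> nat list"
  assumes "N \<ge> 1"
    and "laplacian_mat N L"
    and "irreducible_mat N L"
    and "neighbour_order srt"
  shows "(\<forall>k < N - 1. \<forall>(L', G) \<in> set_pmf (cholesky_state srt L k). L' $$ (k, k) > 0) \<and>
         (\<forall>(L', G) \<in> set_pmf (cholesky_state srt L (N - 1)). L' $$ (N - 1, N - 1) = 0)"
proof -
  have inv: "partially_eliminated N m L'"
    if "m \<le> N" "(L', G) \<in> set_pmf (cholesky_state srt L m)" for m L' G
    using cholesky_state_partially_eliminated[OF assms(4,2,3) that] .
  have "L' $$ (k, k) > 0"
    if "k < N - 1" "(L', G) \<in> set_pmf (cholesky_state srt L k)" for k L' G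
    using partially_eliminated_diag_pos[OF inv[OF _ that(2)]] that(1) by simp
  moreover have "L' $$ (N - 1, N - 1) = 0"
    if "(L', G) \<in> set_pmf (cholesky_state srt L (N - 1))" for L' G
    using partially_eliminated_last_diag[of "N - 1" L'] inv[OF _ that] assms(1) by simp
  ultimately show ?thesis by blast
qed

end
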